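(* Suppose $N$ axion-like fields $a_1,\dots,a_N$, with decay constants $f_1,\dots,f_N$, couple to QCD only through the single effective angle $$\Theta_Q=\theta_Q+\sum_{i=1}^N c_i\frac{a_i}{f_i}.$$ Then the QCD contribution to their mass matrix (with QCD represented in Fried's functional formalism) is $$(M_Q^2)_{ij}=\chi_Q^{\rm F}\,\frac{c_ic_j}{f_if_j}.$$ This matrix has rank one. Therefore QCD in this formalism ("Fried-QCD") alone generates only one massive QCD axion direction.
   Context: The $a_i$ are pseudoscalar fields, the $c_i$ are their coupling coefficients to QCD, and $\theta_Q$ is the constant QCD angle. The QCD contribution to the potential of the fields is the $\Theta$-dependent part of the QCD vacuum energy, $E_{\rm vac}(\Theta_Q)-E_{\rm vac}(0)$, with the small-angle expansion $E_{\rm vac}(\Theta)=E_{\rm vac}(0)+\tfrac12\chi\,\Theta^2+O(\Theta^4)$, where $\chi=\partial^2E_{\rm vac}/\partial\Theta^2|_{\Theta=0}$ is the QCD topological susceptibility. $\chi_Q^{\rm F}$ denotes this susceptibility $\chi$ as evaluated in Fried's nonperturbative QCD functional formalism (the superscript F marks this); for the present statement it enters only as a given constant. The QCD contribution $M_Q^2$ to the mass matrix is the matrix of second derivatives of this potential with respect to $a_i$ and $a_j$, at the minimum $\Theta_Q=0$. A massive direction is a direction in the space of fields $(a_1,\dots,a_N)$ that is an eigenvector of $M_Q^2$ with nonzero eigenvalue. *)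

theory Defs
  imports "HOL-Analysis.Analysis" "HOL-Library.Landau_Symbols"
begin

text \<open>The fields are the components of a vector in \<open>real ^ 'n\<close>, so \<open>N\<close> is \<open>CARD('n)\<close>.\<close>

definition effective_angle ::
    "real \<Rightarrow> real ^ 'n \<Rightarrow> real ^ 'n \<Rightarrow> real ^ 'n \<Rightarrow> real" where
  "effective_angle \<theta> c f a = \<theta> + (\<Sum>i\<in>UNIV. c $ i * (a $ i / f $ i))"

definition qcd_potential ::
    "(real \<Rightarrow> real) \<Rightarrow> real \<Rightarrow> real ^ 'n \<Rightarrow> real ^ 'n \<Rightarrow> real ^ 'n \<Rightarrow> real" where
  "qcd_potential E \<theta> c f a = E (effective_angle \<theta> c f a) - E 0"

definition topological_susceptibility :: "(real \<Rightarrow> real) \<Rightarrow> real" where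
  "topological_susceptibility E = deriv (deriv E) 0"

text \<open>
  The regularity implicit in the expansion
  \<open>E \<Theta> = E 0 + \<chi> \<Theta>\<^sup>2 / 2 + O(\<Theta> ^ 4)\<close> with \<open>\<chi>\<close> a second derivative:
  \<open>E\<close> has a derivative near \<open>0\<close>, and that derivative is differentiable at \<open>0\<close>.
\<close>

definition qcd_vacuum_energy :: "(real \<Rightarrow> real) \<Rightarrow> bool" where
  "qcd_vacuum_energy E \<longleftrightarrow>
     (\<forall>\<^sub>F \<Theta> in nhds 0. E differentiable (at \<Theta>)) \<and>
     deriv E differentiable (at 0) \<and>
     (\<lambda>\<Theta>. E \<Theta> - (E 0 + topological_susceptibility E * \<Theta>\<^sup>2 / 2)) \<in> O[at 0](\<lambda>\<Theta>. \<Theta> ^ 4)"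

definition partial_deriv :: "'n \<Rightarrow> (real ^ 'n \<Rightarrow> real) \<Rightarrow> real ^ 'n \<Rightarrow> real" where
  "partial_deriv i V a = deriv (\<lambda>t. V (a + t *\<^sub>R axis i 1)) 0"

definition mass_matrix :: "(real ^ 'n \<Rightarrow> real) \<Rightarrow> real ^ 'n \<Rightarrow> real ^ 'n ^ 'n" where
  "mass_matrix V a = (\<chi> i j. partial_deriv i (partial_deriv j V) a)"

text \<open>An eigenvector with nonzero eigenvalue; as a direction it is the line \<open>span {v}\<close>.\<close>

definition massive_direction :: "real ^ 'n ^ 'n \<Rightarrow> real ^ 'n \<Rightarrow> bool" where
  "massive_direction M v \<longleftrightarrow> v \<noteq> 0 \<and> (\<exists>m. m \<noteq> 0 \<and> M *v v = m *\<^sub>R v)"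

end

theory Submission
  imports Defs
begin

text \<open>
  Only the combination \<open>g = (c\<^sub>i / f\<^sub>i)\<^sub>i\<close> enters the potential, which is a function of
  \<open>\<theta>\<^sub>Q + g \<bullet> a\<close>. Its Hessian is therefore a multiple of the outer product of \<open>g\<close> with
  itself, whose range is the line through \<open>g\<close>; every eigenvector with nonzero eigenvalue
  lies in the range.
\<close>

lemma effective_angle_shift:
  "effective_angle \<theta> c f (a + t *\<^sub>R axis i 1) = effective_angle \<theta> c f a + t * (c $ i / f $ i)"
proof -
  have "(\<Sum>k\<in>UNIV. c $ k * ((a + t *\<^sub>R axis i 1) $ k / f $ k))
      = (\<Sum>k\<in>UNIV. c $ k * (a $ k / f $ k) + (if k = i then t * (c $ k / f $ k) else 0))"
    by (rule sum.cong) (auto simp: axis_def add_divide_distrib distrib_left)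
  then show ?thesis
    by (simp add: effective_angle_def sum.distrib)
qed

text \<open>Chain rule along a coordinate line, where the potential is \<open>E\<close> of an affine
  function of \<open>t\<close>. The base point is arbitrary because the second derivative needs this
  formula around the minimum, not only at it.\<close>

lemma partial_deriv_qcd_potential:
  assumes "E differentiable (at (effective_angle \<theta> c f a))"
  shows "partial_deriv j (qcd_potential E \<theta> c f) a
       = deriv E (effective_angle \<theta> c f a) * (c $ j / f $ j)"
proof -
  let ?\<Theta> = "effective_angle \<theta> c f a" and ?g = "c $ j / f $ j"
  \<comment> \<open>The summand \<open>0 * ?g\<close> presents the point as the value of the inner
    affine map at \<open>t = 0\<close>, the form \<open>DERIV_chain2\<close> expects.\<close>
  have "(E has_field_derivative deriv E ?\<Theta>) (at (?\<Theta> + 0 * ?g))"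
    using assms by (simp add: DERIV_deriv_iff_real_differentiable)
  moreover have "((\<lambda>t. ?\<Theta> + t * ?g) has_field_derivative ?g) (at 0)"
    by (rule DERIV_add[OF DERIV_const DERIV_cmult_right[OF DERIV_ident], simplified])
  ultimately have "((\<lambda>t. E (?\<Theta> + t * ?g)) has_field_derivative deriv E ?\<Theta> * ?g) (at 0)"
    by (rule DERIV_chain2)
  then have "((\<lambda>t. E (?\<Theta> + t * ?g) - E 0) has_field_derivative deriv E ?\<Theta> * ?g - 0) (at 0)"
    by (intro DERIV_diff DERIV_const)
  then show ?thesis
    unfolding partial_deriv_def qcd_potential_def effective_angle_shift
    by (simp add: DERIV_imp_deriv)
qed

text \<open>Since the angle vanishes at \<open>a\<close>, it equals \<open>t * ?gi\<close> at
  distance \<open>t\<close> along axis \<open>i\<close>. Differentiating once in direction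
  \<open>j\<close> and once in direction \<open>i\<close> pulls out one factor each, leaving the
  second derivative of \<open>E\<close> at 0.\<close>

lemma mass_matrix_qcd_potential:
  assumes E: "qcd_vacuum_energy E" and a: "effective_angle \<theta> c f a = 0"
  shows "mass_matrix (qcd_potential E \<theta> c f) a $ i $ j
       = topological_susceptibility E * (c $ i / f $ i) * (c $ j / f $ j)"
proof -
  let ?gi = "c $ i / f $ i" and ?gj = "c $ j / f $ j"
  \<comment> \<open>\<open>E\<close> is differentiable only near 0, so this neighbourhood is pulled
    back along \<open>t * ?gi\<close>. Using \<open>nhds 0\<close> on both sides also covers
    \<open>?gi = 0\<close>.\<close>
  have "((\<lambda>t. t * ?gi) \<longlongrightarrow> 0 * ?gi) (nhds 0)"
    by (intro tendsto_mult_right filterlim_ident)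
  then have "filterlim (\<lambda>t. t * ?gi) (nhds 0) (nhds 0)"
    by simp
  moreover have "\<forall>\<^sub>F \<Theta> in nhds 0. E differentiable (at \<Theta>)"
    using E by (simp add: qcd_vacuum_energy_def)
  ultimately have "\<forall>\<^sub>F t in nhds 0. E differentiable (at (t * ?gi))"
    by (rule eventually_compose_filterlim[rotated])
  then have ev: "\<forall>\<^sub>F t in nhds 0.
      partial_deriv j (qcd_potential E \<theta> c f) (a + t *\<^sub>R axis i 1) = deriv E (t * ?gi) * ?gj"
    by eventually_elim (subst partial_deriv_qcd_potential; simp add: effective_angle_shift a)
  have "(deriv E has_field_derivative deriv (deriv E) 0) (at (0 * ?gi))"
    using E by (simp add: qcd_vacuum_energy_def DERIV_deriv_iff_real_differentiable)
  moreover have "((\<lambda>t. t * ?gi) has_field_derivative ?gi) (at 0)"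
    by (rule DERIV_cmult_right[OF DERIV_ident, simplified])
  ultimately have "((\<lambda>t. deriv E (t * ?gi)) has_field_derivative deriv (deriv E) 0 * ?gi) (at 0)"
    by (rule DERIV_chain2)
  then have "((\<lambda>t. deriv E (t * ?gi) * ?gj) has_field_derivative
      deriv (deriv E) 0 * ?gi * ?gj) (at 0)"
    by (rule DERIV_cmult_right)
  then have "deriv (\<lambda>t. deriv E (t * ?gi) * ?gj) 0 = deriv (deriv E) 0 * ?gi * ?gj"
    by (rule DERIV_imp_deriv)
  \<comment> \<open>Only the outer partial derivative is unfolded. The closed form of the inner one
    holds just for small \<open>t\<close>, which suffices for the derivative at 0.\<close>
  then show ?thesis
    unfolding mass_matrix_def topological_susceptibility_def vec_lambda_beta
    by (subst partial_deriv_def, subst deriv_cong_ev[OF ev refl])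
qed

lemma outer_product_mult_vec:
  fixes M :: "real ^ 'n ^ 'n"
  assumes "\<And>i j. M $ i $ j = k * g $ i * g $ j"
  shows "M *v v = (k * (g \<bullet> v)) *\<^sub>R g"
  by (simp add: vec_eq_iff matrix_vector_mult_def inner_vec_def assms
      sum_distrib_left sum_distrib_right mult_ac)

lemma rank_outer_product:
  fixes M :: "real ^ 'n ^ 'n"
  assumes M: "\<And>i j. M $ i $ j = k * g $ i * g $ j" and "k \<noteq> 0" "g \<noteq> 0"
  shows "rank M = 1"
proof -
  have "range ((*v) M) = span {g}"
  proof
    show "range ((*v) M) \<subseteq> span {g}"
      by (auto simp: outer_product_mult_vec[OF M] span_singleton)
    \<comment> \<open>The preimage is found by solving \<open>k * (g \<bullet> v) = x\<close> for a
      multiple \<open>v\<close> of \<open>g\<close>.\<close>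
    have "x *\<^sub>R g = M *v ((x / (k * (g \<bullet> g))) *\<^sub>R g)" for x
      using assms(2,3) by (simp add: outer_product_mult_vec[OF M])
    then show "span {g} \<subseteq> range ((*v) M)"
      unfolding span_singleton by blast
  qed
  then show ?thesis
    using \<open>g \<noteq> 0\<close> by (simp add: rank_dim_range)
qed

text \<open>A nonzero eigenvalue can be divided out, which forces \<open>v\<close> onto the line of
  \<open>g\<close>. Conversely, that whole line is scaled by \<open>k * (g \<bullet> g)\<close>,
  which is nonzero.\<close>

lemma massive_direction_outer_product:
  fixes M :: "real ^ 'n ^ 'n"
  assumes M: "\<And>i j. M $ i $ j = k * g $ i * g $ j" and "k \<noteq> 0" "g \<noteq> 0"
  shows "massive_direction M v \<longleftrightarrow> v \<noteq> 0 \<and> v \<in> span {g}"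
proof
  assume "massive_direction M v"
  then obtain m where "v \<noteq> 0" "m \<noteq> 0" and "(k * (g \<bullet> v)) *\<^sub>R g = m *\<^sub>R v"
    by (auto simp: massive_direction_def outer_product_mult_vec[OF M])
  then have "v = (k * (g \<bullet> v) / m) *\<^sub>R g"
    by (simp add: vec_eq_iff field_simps)
  then show "v \<noteq> 0 \<and> v \<in> span {g}"
    using \<open>v \<noteq> 0\<close> by (auto simp: span_singleton)
next
  assume "v \<noteq> 0 \<and> v \<in> span {g}"
  then obtain x where "v = x *\<^sub>R g" "v \<noteq> 0"
    by (auto simp: span_singleton)
  then have "M *v v = (k * (g \<bullet> g)) *\<^sub>R v"
    by (simp add: outer_product_mult_vec[OF M])
  then show "massive_direction M v"
    unfolding massive_direction_def using assms(2,3) \<open>v \<noteq> 0\<close>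
    by (intro conjI exI[of _ "k * (g \<bullet> g)"]) auto
qed

text \<open>Eigenvectors are fixed only up to scale; this passes from vectors to the line they
  share, which is what uniqueness of the direction concerns.\<close>

lemma span_singleton_eq:
  fixes v w :: "'a::real_vector"
  assumes "v \<in> span {w}" "v \<noteq> 0"
  shows "span {v} = span {w}"
proof -
  obtain x where x: "v = x *\<^sub>R w" "x \<noteq> 0"
    using assms by (auto simp: span_singleton)
  then have "w = inverse x *\<^sub>R v"
    by simp
  then have "w \<in> span {v}"
    by (simp add: span_singleton) (metis rangeI)
  with assms show ?thesis
    by (intro span_eq[THEN iffD2]) auto
qed

theorem theorem2:
  fixes E :: "real \<Rightarrow> real"
    and \<theta>\<^sub>Q \<chi>\<^sub>F :: real
    and c f a\<^sub>0 :: "real ^ 'n"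
    and M :: "real ^ 'n ^ 'n"
  assumes decay_constants: "\<And>i. f $ i \<noteq> 0"
    and vacuum_energy: "qcd_vacuum_energy E"
    and susceptibility: "\<chi>\<^sub>F = topological_susceptibility E"
    and zero_angle: "effective_angle \<theta>\<^sub>Q c f a\<^sub>0 = 0"
    and M: "M = mass_matrix (qcd_potential E \<theta>\<^sub>Q c f) a\<^sub>0"
  shows "(\<forall>i j. M $ i $ j = \<chi>\<^sub>F * (c $ i * c $ j / (f $ i * f $ j))) \<and>
         (\<chi>\<^sub>F \<noteq> 0 \<and> c \<noteq> 0 \<longrightarrow>
            rank M = 1 \<and>
            (\<exists>!L. \<exists>v. massive_direction M v \<and> L = span {v}))"
proof (intro conjI allI impI)
  define g where "g = (\<chi> i. c $ i / f $ i)"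
  have Mg: "M $ i $ j = \<chi>\<^sub>F * g $ i * g $ j" for i j
    using mass_matrix_qcd_potential[OF vacuum_energy zero_angle]
    by (simp add: M susceptibility g_def)
  then show "M $ i $ j = \<chi>\<^sub>F * (c $ i * c $ j / (f $ i * f $ j))" for i j
    by (simp add: g_def)
  assume nz: "\<chi>\<^sub>F \<noteq> 0 \<and> c \<noteq> 0"
  \<comment> \<open>A nonzero component of \<open>c\<close> survives division by a nonzero decay
    constant; with \<open>f $ i = 0\<close> the quotient would be 0 by convention.\<close>
  then have g: "g \<noteq> 0"
    using decay_constants by (auto simp: g_def vec_eq_iff)
  show "rank M = 1"
    using rank_outer_product[OF Mg] nz g by blast
  note massive = massive_direction_outer_product[OF Mg conjunct1[OF nz] g]
  show "\<exists>!L. \<exists>v. massive_direction M v \<and> L = span {v}"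
  proof (rule ex1I)
    show "\<exists>v. massive_direction M v \<and> span {g} = span {v}"
      using g by (auto simp: massive intro!: exI[of _ g] span_base)
    show "L = span {g}" if "\<exists>v. massive_direction M v \<and> L = span {v}" for L
      using that span_singleton_eq by (auto simp: massive)
  qed
qed

end
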